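(* Let $\phi=\sum_{i=0}^4 b_{i,4-i}\frac{x^i}{i!}\frac{y^{4-i}}{(4-i)!}$ be a regular binary $4$-form, and let $$\alpha=4b_{13}b_{31}-b_{40}b_{04}-3b_{22}^2,\qquad \delta=b_{22}b_{40}b_{04}-b_{04}b_{31}^2-b_{40}b_{13}^2+2b_{13}b_{22}b_{31}-b_{22}^3 .$$ Then the $\mathrm{SL}_2(\mathbb{C})$-orbit of $\phi$ consists of solutions to the third order differential equation $$9J_3^2+16J_2^3+144\,\alpha\,J_0^2J_2+864\,\delta\,J_0^3=0$$ together with $\mathcal{E}_4$. Here $\alpha,\delta$ are constants computed from the fixed form $\phi$, and $J_0,J_2,J_3$ and $\mathcal{E}_4$ are defined in the context.
   Context: A binary $4$-form is a homogeneous polynomial of degree $4$ in $(x,y)$ on $\mathbb{C}^2$ with complex coefficients; the space of them is $\mathcal{B}_4\simeq\mathbb{C}^5$. $\mathrm{SL}_2(\mathbb{C})$ acts on functions by $Af=f\circ A^{-1}$, hence on $\mathcal{B}_4$. Regularity: a form $\phi\in\mathcal{B}_4$ is regular if its orbit is regular, i.e. the corresponding point of the quotient $\mathcal{B}_4/\mathrm{SL}_2(\mathbb{C})$ is smooth: there exist two rational $\mathrm{SL}_2(\mathbb{C})$-invariants $I_1,I_2$ on $\mathcal{B}_4$, independent ($dI_1\wedge dI_2\neq0$) in a neighborhood of the orbit, such that the orbit is given by the equations $I_1=c_1$, $I_2=c_2$ with constants $c_1,c_2$. Jet notation: $u_{ij}$ are the canonical coordinates on the spaces of jets of functions on $\mathbb{C}^2$;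 on a function $f(x,y)$, $u_{ij}$ takes the value $\partial^{i+j}f/\partial x^i\partial y^j$. The total derivatives are $\frac{d}{dx}=\partial_x+\sum u_{i+1,j}\partial_{u_{ij}}$, $\frac{d}{dy}=\partial_y+\sum u_{i,j+1}\partial_{u_{ij}}$. $J_0=u_{00}$, $J_2=u_{20}u_{02}-u_{11}^2$, $J_3=-\nabla_1(J_2)$, where $\nabla_1=u_{01}\frac{d}{dx}-u_{10}\frac{d}{dy}$. The system $\mathcal{E}_4$ consists of the Euler equation $xu_{10}+yu_{01}=4u_{00}$, its total derivatives $\frac{d^{k+l}}{dx^kdy^l}(xu_{10}+yu_{01}-4u_{00})=0$ for $0\le k+l\le 3$, and the equations $u_{ij}=0$ for $i+j\ge5$; binary $4$-forms are solutions of it. *)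

theory Defs
  imports "HOL-Analysis.Analysis"
begin

definition SL2 :: "(complex^2^2) set" where
  "SL2 = {A. det A = 1}"

definition act :: "complex^2^2 \<Rightarrow> (complex^2 \<Rightarrow> complex) \<Rightarrow> complex^2 \<Rightarrow> complex" where
  "act A f = f \<circ> (\<lambda>v. matrix_inv A *v v)"

definition SL2_orbit :: "(complex^2 \<Rightarrow> complex) \<Rightarrow> (complex^2 \<Rightarrow> complex) set" where
  "SL2_orbit f = (\<lambda>A. act A f) ` SL2"

text \<open>Only the values \<open>b i (4 - i)\<close>, for \<open>i \<le> 4\<close>, enter the form with coefficients \<open>b\<close>.\<close>

definition binary_quartic :: "(nat \<Rightarrow> nat \<Rightarrow> complex) \<Rightarrow> complex^2 \<Rightarrow> complex" where
  "binary_quartic b v =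
     (\<Sum>i=0..4. b i (4 - i) * ((v $ 1) ^ i / fact i) * ((v $ 2) ^ (4 - i) / fact (4 - i)))"

text \<open>The identification of \<open>\<complex>\<^sup>5\<close> with the space of binary quartics: the coordinate with index
  \<open>i\<close>, taken modulo 5, is the coefficient \<open>b i (4 - i)\<close>.\<close>

definition quartic_of :: "complex^5 \<Rightarrow> complex^2 \<Rightarrow> complex" where
  "quartic_of c = binary_quartic (\<lambda>i j. c $ of_nat i)"

inductive poly_fun :: "(complex^5 \<Rightarrow> complex) \<Rightarrow> bool" where
  const: "poly_fun (\<lambda>c. a)"
| coord: "poly_fun (\<lambda>c. c $ i)"
| add: "poly_fun p \<Longrightarrow> poly_fun q \<Longrightarrow> poly_fun (\<lambda>c. p c + q c)"
| mult: "poly_fun p \<Longrightarrow> poly_fun q \<Longrightarrow> poly_fun (\<lambda>c. p c * q c)"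

text \<open>\<open>p\<close> and \<open>q\<close> are numerator and denominator of a rational function on the space of binary
  quartics; its invariance is required wherever both sides are defined.\<close>

definition rational_invariant :: "(complex^5 \<Rightarrow> complex) \<Rightarrow> (complex^5 \<Rightarrow> complex) \<Rightarrow> bool" where
  "rational_invariant p q \<longleftrightarrow>
     poly_fun p \<and> poly_fun q \<and> (\<exists>c. q c \<noteq> 0) \<and>
     (\<forall>A\<in>SL2. \<forall>c d. quartic_of d = act A (quartic_of c) \<and> q c \<noteq> 0 \<and> q d \<noteq> 0 \<longrightarrow>
        p c / q c = p d / q d)"

definition wedge_nonzero_at ::
  "(complex^5 \<Rightarrow> complex) \<Rightarrow> (complex^5 \<Rightarrow> complex) \<Rightarrow> complex^5 \<Rightarrow> bool" where
  "wedge_nonzero_at I1 I2 c \<longleftrightarrow>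
     (\<exists>h k. frechet_derivative I1 (at c) h * frechet_derivative I2 (at c) k
          - frechet_derivative I1 (at c) k * frechet_derivative I2 (at c) h \<noteq> 0)"

definition regular :: "(complex^2 \<Rightarrow> complex) \<Rightarrow> bool" where
  "regular f \<longleftrightarrow> f \<in> range quartic_of \<and>
     (\<exists>p1 q1 p2 q2 U c1 c2.
        rational_invariant p1 q1 \<and> rational_invariant p2 q2 \<and>
        open U \<and> quartic_of -` SL2_orbit f \<subseteq> U \<and>
        (\<forall>c\<in>U. q1 c \<noteq> 0 \<and> q2 c \<noteq> 0 \<and>
           wedge_nonzero_at (\<lambda>c. p1 c / q1 c) (\<lambda>c. p2 c / q2 c) c) \<and>
        quartic_of -` SL2_orbit f =
          {c. q1 c \<noteq> 0 \<and> q2 c \<noteq> 0 \<and> p1 c / q1 c = c1 \<and> p2 c / q2 c = c2})"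

text \<open>A jet is given by \<open>x\<close>, \<open>y\<close> and the coordinates \<open>u\<^sub>i\<^sub>j\<close>. A function on a space of
  \<open>k\<close>-jets is a function of type \<open>jet \<Rightarrow> complex\<close> depending only on the \<open>u\<^sub>i\<^sub>j\<close> with
  \<open>i + j \<le> k\<close>.\<close>

type_synonym jet = "complex \<times> complex \<times> (nat \<Rightarrow> nat \<Rightarrow> complex)"

definition jet_x :: "jet \<Rightarrow> complex" where "jet_x = (\<lambda>(x, y, u). x)"
definition jet_y :: "jet \<Rightarrow> complex" where "jet_y = (\<lambda>(x, y, u). y)"
definition jet_u :: "nat \<Rightarrow> nat \<Rightarrow> jet \<Rightarrow> complex" where "jet_u i j = (\<lambda>(x, y, u). u i j)"

definition pd_x :: "(jet \<Rightarrow> complex) \<Rightarrow> jet \<Rightarrow> complex" where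
  "pd_x F = (\<lambda>(x, y, u). deriv (\<lambda>t. F (t, y, u)) x)"

definition pd_y :: "(jet \<Rightarrow> complex) \<Rightarrow> jet \<Rightarrow> complex" where
  "pd_y F = (\<lambda>(x, y, u). deriv (\<lambda>t. F (x, t, u)) y)"

definition pd_u :: "nat \<Rightarrow> nat \<Rightarrow> (jet \<Rightarrow> complex) \<Rightarrow> jet \<Rightarrow> complex" where
  "pd_u i j F = (\<lambda>(x, y, u). deriv (\<lambda>t. F (x, y, u(i := (u i)(j := t)))) (u i j))"

text \<open>The sums run over the indices with a nonzero summand coefficient; for a function on a space
  of jets of finite order this is a finite set.\<close>

definition total_dx :: "(jet \<Rightarrow> complex) \<Rightarrow> jet \<Rightarrow> complex" where
  "total_dx F p =
     pd_x F p + (\<Sum>(i, j)\<in>{(i, j). pd_u i j F p \<noteq> 0}. jet_u (i + 1) j p * pd_u i j F p)"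

definition total_dy :: "(jet \<Rightarrow> complex) \<Rightarrow> jet \<Rightarrow> complex" where
  "total_dy F p =
     pd_y F p + (\<Sum>(i, j)\<in>{(i, j). pd_u i j F p \<noteq> 0}. jet_u i (j + 1) p * pd_u i j F p)"

definition nabla1 :: "(jet \<Rightarrow> complex) \<Rightarrow> jet \<Rightarrow> complex" where
  "nabla1 F p = jet_u 0 1 p * total_dx F p - jet_u 1 0 p * total_dy F p"

definition J0 :: "jet \<Rightarrow> complex" where
  "J0 = jet_u 0 0"

definition J2 :: "jet \<Rightarrow> complex" where
  "J2 p = jet_u 2 0 p * jet_u 0 2 p - (jet_u 1 1 p)\<^sup>2"

definition J3 :: "jet \<Rightarrow> complex" where
  "J3 p = - nabla1 J2 p"

text \<open>A differential equation is represented by the function on jets that is required to vanish.\<close>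

definition euler4 :: "jet \<Rightarrow> complex" where
  "euler4 p = jet_x p * jet_u 1 0 p + jet_y p * jet_u 0 1 p - 4 * jet_u 0 0 p"

definition E4 :: "(jet \<Rightarrow> complex) set" where
  "E4 = {(total_dx ^^ k) ((total_dy ^^ l) euler4) | k l. k + l \<le> 3} \<union>
        {jet_u i j | i j. i + j \<ge> 5}"

definition quartic_ode :: "complex \<Rightarrow> complex \<Rightarrow> jet \<Rightarrow> complex" where
  "quartic_ode \<alpha> \<delta> p =
     9 * (J3 p)\<^sup>2 + 16 * (J2 p) ^ 3 + 144 * \<alpha> * (J0 p)\<^sup>2 * J2 p + 864 * \<delta> * (J0 p) ^ 3"

definition partial_x :: "(complex^2 \<Rightarrow> complex) \<Rightarrow> complex^2 \<Rightarrow> complex" where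
  "partial_x f v = deriv (\<lambda>t. f (vector [t, v $ 2])) (v $ 1)"

definition partial_y :: "(complex^2 \<Rightarrow> complex) \<Rightarrow> complex^2 \<Rightarrow> complex" where
  "partial_y f v = deriv (\<lambda>t. f (vector [v $ 1, t])) (v $ 2)"

definition jet_at :: "(complex^2 \<Rightarrow> complex) \<Rightarrow> complex^2 \<Rightarrow> jet" where
  "jet_at f v = (v $ 1, v $ 2, \<lambda>i j. (partial_x ^^ i) ((partial_y ^^ j) f) v)"

definition entire2 :: "(complex^2 \<Rightarrow> complex) \<Rightarrow> bool" where
  "entire2 f \<longleftrightarrow> (\<forall>v. \<exists>a b. (f has_derivative (\<lambda>h. a * h $ 1 + b * h $ 2)) (at v))"

definition is_solution :: "(jet \<Rightarrow> complex) set \<Rightarrow> (complex^2 \<Rightarrow> complex) \<Rightarrow> bool" where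
  "is_solution S f \<longleftrightarrow> entire2 f \<and> (\<forall>F\<in>S. \<forall>v. F (jet_at f v) = 0)"

end

(* Every quartic with a simple root can be moved by SL2 to W(p, q) = x (y^3 + p x^2 y + q x^3), a
   Weierstrass form; the remaining quartics lie in the orbit of c x^2 y^2 or of c x^4.
   The latter are not regular: they are limits of c x^2 y^2 + t x^4, respectively c x^4 + t x^3 y,
   as t -> 0. For nonzero t these are all equivalent, so a rational invariant cannot tell them
   from the limit, whose Hessian is proportional to the form, unlike theirs.
   A quartic solves the equation with its own values of alpha and delta (the syzygy between
   the covariants J0, J2, J3), and the equation is SL2-invariant. Conversely W(p, q)
   solves it only for alpha = 144 p and delta = -864 q. Hence regular solutions with the
   same alpha and delta have the same normal form. *)

theory Submission
  imports Defs "HOL-Computational_Algebra.Fundamental_Theorem_Algebra"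
begin

section \<open>Orbits\<close>

lemma SL2_orbit_eq: "SL2_orbit f = {f \<circ> (*v) B |B. det B = 1}"
proof -
  have inv: "invertible A" "A ** matrix_inv A = mat 1" "matrix_inv A ** A = mat 1" "det (matrix_inv A) = 1"
    if "det A = 1" for A :: "complex^2^2"
  proof -
    show i: "invertible A" using that by (simp add: invertible_det_nz)
    \<comment> \<open>\<open>matrix_inv\<close> is a choice operator; exhibiting some two-sided
      inverse gives access to its properties.\<close>
    then obtain A' where "A ** A' = mat 1 \<and> A' ** A = mat 1" by (auto simp: invertible_def)
    then have *: "A ** matrix_inv A = mat 1 \<and> matrix_inv A ** A = mat 1"
      unfolding matrix_inv_def by (rule someI)
    then show "A ** matrix_inv A = mat 1" "matrix_inv A ** A = mat 1" by auto
    have "det A * det (matrix_inv A) = 1" using * by (metis det_mul det_I)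
    then show "det (matrix_inv A) = 1" using that by simp
  qed
  have inv_inv: "matrix_inv (matrix_inv A) = A" if "det A = 1" for A :: "complex^2^2"
    using inv[OF that] inv[OF inv(4)[OF that]]
    by (metis matrix_mul_assoc matrix_mul_lid matrix_mul_rid)
  show ?thesis
  proof (intro equalityI subsetI)
    fix g assume "g \<in> SL2_orbit f"
    then show "g \<in> {f \<circ> (*v) B |B. det B = 1}"
      using inv(4) by (auto simp: SL2_orbit_def act_def SL2_def)
  next
    fix g assume "g \<in> {f \<circ> (*v) B |B. det B = 1}"
    then obtain B where B: "g = f \<circ> (*v) B" "det B = 1" by blast
    then have "g = act (matrix_inv B) f" by (simp add: act_def inv_inv)
    then show "g \<in> SL2_orbit f" using inv(4)[OF B(2)] by (auto simp: SL2_orbit_def SL2_def)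
  qed
qed

lemma SL2_orbit_refl: "f \<in> SL2_orbit f"
  unfolding SL2_orbit_eq by (auto intro!: exI[of _ "mat 1"] simp: o_def det_I)

lemma SL2_orbit_sym:
  assumes "g \<in> SL2_orbit f" shows "f \<in> SL2_orbit g"
proof -
  obtain B where B: "g = f \<circ> (*v) B" "det B = 1" using assms by (auto simp: SL2_orbit_eq)
  then have "invertible B" by (simp add: invertible_det_nz)
  then obtain B' where B': "B ** B' = mat 1" by (auto simp: invertible_def)
  then have "det B * det B' = 1" by (metis det_mul det_I)
  then have "det B' = 1" using B by simp
  moreover have "f = g \<circ> (*v) B'" using B B' by (simp add: o_def matrix_vector_mul_assoc)
  ultimately show ?thesis by (auto simp: SL2_orbit_eq)
qed

lemma SL2_orbit_trans:
  assumes "g \<in> SL2_orbit f" "h \<in> SL2_orbit g" shows "h \<in> SL2_orbit f"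
proof -
  obtain B C where "g = f \<circ> (*v) B" "det B = 1" "h = g \<circ> (*v) C" "det C = 1"
    using assms by (auto simp: SL2_orbit_eq)
  then have "h = f \<circ> (*v) (B ** C)" "det (B ** C) = 1"
    by (simp_all add: o_def matrix_vector_mul_assoc det_mul)
  then show ?thesis by (auto simp: SL2_orbit_eq)
qed

lemma SL2_orbit_cong:
  assumes "g \<in> SL2_orbit f" shows "SL2_orbit g = SL2_orbit f"
  using assms SL2_orbit_sym SL2_orbit_trans by blast

lemma matrix2_mult: "(B *v v) $ 1 = B$1$1 * v$1 + B$1$2 * v$2" "(B *v v) $ 2 = B$2$1 * v$1 + B$2$2 * v$2"
  for B :: "complex^2^2"
  by (simp_all add: matrix_vector_mult_def sum_2)

lemma substitution_in_orbit:
  assumes "a * d - b * c = 1"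
    and "\<And>v. g v = f (vector [a * v$1 + b * v$2, c * v$1 + d * v$2])"
  shows "g \<in> SL2_orbit f"
proof -
  define B :: "complex^2^2" where "B = vector [vector [a, b], vector [c, d]]"
  have "B *v v = vector [a * v$1 + b * v$2, c * v$1 + d * v$2]" for v
    by (simp add: vec_eq_iff forall_2 matrix2_mult B_def)
  moreover have "det B = 1" using assms(1) by (simp add: det_2 B_def)
  ultimately show ?thesis using assms(2) unfolding SL2_orbit_eq by (auto simp: o_def fun_eq_iff intro!: exI[of _ B])
qed

section \<open>Binary forms and their jets\<close>

text \<open>Complex differentiability with both partial derivatives named. Unlike
  \<open>partial_x\<close> and \<open>partial_y\<close>, which are one-variable derivatives along
  coordinate lines, this notion obeys the chain rule for linear substitutions directly.\<close>

definition has_partials ::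
  "(complex^2 \<Rightarrow> complex) \<Rightarrow> (complex^2 \<Rightarrow> complex) \<Rightarrow> (complex^2 \<Rightarrow> complex) \<Rightarrow> bool" where
  "has_partials f p q \<longleftrightarrow> (\<forall>v. (f has_derivative (\<lambda>h. p v * h$1 + q v * h$2)) (at v))"

text \<open>The chain rule along the two coordinate lines through \<open>v\<close>; these are affine
  and are split into a linear part and a constant.\<close>

lemma partial_has_partials:
  assumes "has_partials f p q"
  shows "partial_x f = p" "partial_y f = q"
proof -
  have lin: "bounded_linear (\<lambda>t::complex. vector [t, 0] :: complex^2)"
            "bounded_linear (\<lambda>t::complex. vector [0, t] :: complex^2)"
    unfolding linear_conv_bounded_linear[symmetric]
    by (auto intro!: linearI simp: vec_eq_iff forall_2)
  have "partial_x f v = p v \<and> partial_y f v = q v" for v :: "complex^2"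
  proof -
    have v: "v = vector [v$1, v$2]" by (simp add: vec_eq_iff forall_2)
    have f: "(f has_derivative (\<lambda>h. p v * h$1 + q v * h$2)) (at (vector [v$1, v$2]))"
      using assms v by (simp add: has_partials_def)
    have 1: "((\<lambda>t. vector [t, v$2] :: complex^2) has_derivative (\<lambda>h. vector [h, 0])) (at (v$1))"
    proof -
      have "((\<lambda>t. vector [t, 0] + vector [0, v$2] :: complex^2) has_derivative (\<lambda>h. vector [h, 0] + 0)) (at (v$1))"
        by (intro has_derivative_add bounded_linear_imp_has_derivative lin has_derivative_const)
      moreover have "(\<lambda>t. vector [t, 0] + vector [0, v$2] :: complex^2) = (\<lambda>t. vector [t, v$2])"
        by (auto simp: fun_eq_iff vec_eq_iff forall_2)
      ultimately show ?thesis by simp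
    qed
    have 2: "((\<lambda>t. vector [v$1, t] :: complex^2) has_derivative (\<lambda>h. vector [0, h])) (at (v$2))"
    proof -
      have "((\<lambda>t. vector [0, t] + vector [v$1, 0] :: complex^2) has_derivative (\<lambda>h. vector [0, h] + 0)) (at (v$2))"
        by (intro has_derivative_add bounded_linear_imp_has_derivative lin has_derivative_const)
      moreover have "(\<lambda>t. vector [0, t] + vector [v$1, 0] :: complex^2) = (\<lambda>t. vector [v$1, t])"
        by (auto simp: fun_eq_iff vec_eq_iff forall_2)
      ultimately show ?thesis by simp
    qed
    have "((\<lambda>t. f (vector [t, v$2])) has_derivative (\<lambda>h. p v * h)) (at (v$1))"
      using has_derivative_compose[OF 1 f] by simp
    then have px: "partial_x f v = p v" unfolding partial_x_def
      by (intro DERIV_imp_deriv) (simp add: has_field_derivative_def)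
    have "((\<lambda>t. f (vector [v$1, t])) has_derivative (\<lambda>h. q v * h)) (at (v$2))"
      using has_derivative_compose[OF 2 f] by simp
    then have "partial_y f v = q v" unfolding partial_y_def
      by (intro DERIV_imp_deriv) (simp add: has_field_derivative_def)
    with px show ?thesis ..
  qed
  then show "partial_x f = p" "partial_y f = q" by auto
qed

lemma has_partials_cmult_add:
  assumes "has_partials f p q" "has_partials g r s"
  shows "has_partials (\<lambda>v. c * f v + d * g v) (\<lambda>v. c * p v + d * r v) (\<lambda>v. c * q v + d * s v)"
  unfolding has_partials_def
proof
  fix v
  have "((\<lambda>v. c * f v + d * g v) has_derivative
      (\<lambda>h. c * (p v * h$1 + q v * h$2) + d * (r v * h$1 + s v * h$2))) (at v)"
    using assms by (auto simp: has_partials_def intro!: has_derivative_add has_derivative_mult_right)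
  then show "((\<lambda>v. c * f v + d * g v) has_derivative
      (\<lambda>h. (c * p v + d * r v) * h$1 + (c * q v + d * s v) * h$2)) (at v)"
    by (simp add: algebra_simps)
qed

lemma has_partials_comp:
  fixes B :: "complex^2^2"
  assumes "has_partials f p q"
  shows "has_partials (\<lambda>v. f (B *v v)) (\<lambda>v. B$1$1 * p (B *v v) + B$2$1 * q (B *v v))
     (\<lambda>v. B$1$2 * p (B *v v) + B$2$2 * q (B *v v))"
  unfolding has_partials_def
proof
  fix v
  have "((\<lambda>v. B *v v) has_derivative (\<lambda>h. B *v h)) (at v)"
    by (intro bounded_linear_imp_has_derivative) simp
  from has_derivative_compose[OF this assms[unfolded has_partials_def, rule_format]]
  have "((\<lambda>v. f (B *v v)) has_derivative
     (\<lambda>h. p (B *v v) * (B *v h)$1 + q (B *v v) * (B *v h)$2)) (at v)" .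
  then show "((\<lambda>v. f (B *v v)) has_derivative
    (\<lambda>h. (B$1$1 * p (B *v v) + B$2$1 * q (B *v v)) * h$1 +
     (B$1$2 * p (B *v v) + B$2$2 * q (B *v v)) * h$2)) (at v)"
    by (simp add: matrix2_mult algebra_simps)
qed

text \<open>In the basis of divided powers \<open>a i\<close> is the derivative of order
  \<open>i\<close> in x and \<open>n - i\<close> in y, so differentiation merely shifts the
  coefficient sequence and lowers the degree.\<close>

definition form :: "nat \<Rightarrow> (nat \<Rightarrow> complex) \<Rightarrow> complex^2 \<Rightarrow> complex" where
  "form n a v = (\<Sum>i\<le>n. a i * ((v$1) ^ i / fact i) * ((v$2) ^ (n - i) / fact (n - i)))"

lemma binary_quartic_form: "binary_quartic b = form 4 (\<lambda>i. b i (4 - i))"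
  by (simp add: fun_eq_iff binary_quartic_def form_def atMost_atLeast0)

lemma has_partials_const: "has_partials (\<lambda>v. c) (\<lambda>v. 0) (\<lambda>v. 0)"
  by (simp add: has_partials_def)

lemma form_0: "form 0 a = (\<lambda>v. a 0)"
  by (simp add: form_def fun_eq_iff)

lemma pow_fact_cancel: "of_nat (Suc i) * z ^ i / fact (Suc i) = z ^ i / (fact i :: complex)"
  by (simp del: of_nat_Suc)

lemma has_partials_form: "has_partials (form (Suc n) a) (form n (\<lambda>i. a (Suc i))) (form n a)"
  unfolding has_partials_def
proof
  fix v :: "complex^2"
  let ?x = "v$1" and ?y = "v$2"
  define A where "A i = a i * (of_nat i * ?x^(i-1) / fact i) * (?y^(Suc n - i) / fact (Suc n - i))" for i
  define C where "C i = a i * (?x^i / fact i) * (of_nat (Suc n - i) * ?y^(Suc n - i - 1) / fact (Suc n - i))" for i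
  have "(form (Suc n) a has_derivative (\<lambda>h. \<Sum>i\<le>Suc n. A i * h$1 + C i * h$2)) (at v)"
    unfolding form_def
  proof (rule has_derivative_sum)
    fix i
    have "((\<lambda>v::complex^2. v$j ^ m / fact m) has_derivative
        (\<lambda>h. h$j * (of_nat m * v$j ^ (m - 1) / fact m))) (at v)" for j m
    proof -
      have "((\<lambda>z::complex. z ^ m / fact m) has_field_derivative of_nat m * v$j ^ (m - 1) / fact m) (at (v$j))"
        by (auto intro!: derivative_eq_intros)
      from has_derivative_compose[OF bounded_linear_imp_has_derivative[OF bounded_linear_vec_nth]
          this[unfolded has_field_derivative_def]]
      show ?thesis by (simp add: mult.commute)
    qed
    from has_derivative_mult[OF has_derivative_mult_right[OF this] this]
    show "((\<lambda>v. a i * ((v$1) ^ i / fact i) * ((v$2) ^ (Suc n - i) / fact (Suc n - i)))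
        has_derivative (\<lambda>h. A i * h$1 + C i * h$2)) (at v)"
      by (rule has_derivative_eq_rhs) (simp add: A_def C_def fun_eq_iff algebra_simps)
  qed
  moreover have "(\<Sum>i\<le>Suc n. A i * h$1 + C i * h$2) = form n (\<lambda>i. a (Suc i)) v * h$1 + form n a v * h$2" for h :: "complex^2"
  proof -
    \<comment> \<open>The factor \<open>of_nat i\<close> kills the term \<open>i = 0\<close>, where
      \<open>i - 1\<close> is truncated; likewise \<open>C (Suc n)\<close> vanishes below.\<close>
    have "(\<Sum>i\<le>Suc n. A i) = (\<Sum>i\<le>n. A (Suc i))"
      by (subst sum.atMost_Suc_shift) (simp add: A_def)
    also have "\<dots> = form n (\<lambda>i. a (Suc i)) v"
      unfolding form_def A_def
      by (intro sum.cong refl) (simp del: of_nat_Suc fact_Suc add: pow_fact_cancel)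
    finally have 1: "(\<Sum>i\<le>Suc n. A i) = form n (\<lambda>i. a (Suc i)) v" .
    have "(\<Sum>i\<le>Suc n. C i) = (\<Sum>i\<le>n. C i)" by (simp add: C_def)
    also have "\<dots> = form n a v"
      unfolding form_def C_def
      by (intro sum.cong refl) (simp del: of_nat_Suc fact_Suc add: pow_fact_cancel Suc_diff_le)
    finally have 2: "(\<Sum>i\<le>Suc n. C i) = form n a v" .
    show ?thesis by (simp only: sum.distrib sum_distrib_right[symmetric] 1 2)
  qed
  ultimately show "(form (Suc n) a has_derivative
    (\<lambda>h. form n (\<lambda>i. a (Suc i)) v * h$1 + form n a v * h$2)) (at v)" by (simp only:)
qed

text \<open>The monomial of index \<open>i\<close> is counted \<open>i\<close> times by the x-term
  and \<open>Suc n - i\<close> times by the y-term.\<close>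

lemma euler_form:
  "v$1 * form n (\<lambda>i. a (Suc i)) v + v$2 * form n a v = of_nat (Suc n) * form (Suc n) a v"
proof -
  let ?x = "v$1" and ?y = "v$2"
  define T where "T i = a i * (?x ^ i / fact i) * (?y ^ (Suc n - i) / fact (Suc n - i))" for i
  have "v$1 * form n (\<lambda>i. a (Suc i)) v = (\<Sum>i\<le>n. of_nat (Suc i) * T (Suc i))"
    unfolding form_def T_def sum_distrib_left
    by (intro sum.cong refl) (simp add: field_simps del: of_nat_Suc)
  also have "\<dots> = (\<Sum>i\<le>Suc n. of_nat i * T i)"
    by (subst sum.atMost_Suc_shift) simp
  finally have 1: "v$1 * form n (\<lambda>i. a (Suc i)) v = (\<Sum>i\<le>Suc n. of_nat i * T i)" .
  have "v$2 * form n a v = (\<Sum>i\<le>n. of_nat (Suc n - i) * T i)"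
    unfolding form_def T_def sum_distrib_left
    by (intro sum.cong refl) (simp add: field_simps Suc_diff_le del: of_nat_Suc)
  also have "\<dots> = (\<Sum>i\<le>Suc n. of_nat (Suc n - i) * T i)" by simp
  finally have 2: "v$2 * form n a v = (\<Sum>i\<le>Suc n. of_nat (Suc n - i) * T i)" .
  have "(\<Sum>i\<le>Suc n. of_nat i * T i) + (\<Sum>i\<le>Suc n. of_nat (Suc n - i) * T i)
      = (\<Sum>i\<le>Suc n. of_nat (Suc n) * T i)"
    unfolding sum.distrib[symmetric]
    by (intro sum.cong refl) (simp add: of_nat_diff algebra_simps)
  then show ?thesis unfolding 1 2 by (simp only: form_def T_def sum_distrib_left)
qed

text \<open>All iterated partial derivatives in closed form. Above order \<open>n\<close> the value
  0 is set explicitly, as the truncated degree would yield a constant form.\<close>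

definition form_jet :: "nat \<Rightarrow> (nat \<Rightarrow> complex) \<Rightarrow> nat \<Rightarrow> nat \<Rightarrow> complex^2 \<Rightarrow> complex" where
  "form_jet n a i j = (if i + j \<le> n then form (n - (i + j)) (\<lambda>k. a (k + i)) else (\<lambda>v. 0))"

lemma has_partials_form_jet:
  "has_partials (form_jet n a i j) (form_jet n a (Suc i) j) (form_jet n a i (Suc j))"
proof -
  consider "i + j < n" | "i + j = n" | "i + j > n" by linarith
  then show ?thesis
  proof cases
    case 1
    then obtain m where "n - (i + j) = Suc m" "n - Suc (i + j) = m"
      by (metis Suc_diff_Suc)
    then show ?thesis using 1 has_partials_form[of m "\<lambda>k. a (k + i)"] by (simp add: form_jet_def)
  qed (simp_all add: form_jet_def form_0 has_partials_const)
qed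

lemma jet_at_form: "jet_at (form n a) v = (v$1, v$2, \<lambda>i j. form_jet n a i j v)"
proof -
  have y: "(partial_y ^^ j) (form n a) = form_jet n a 0 j" for j
  proof (induction j)
    case 0 show ?case by (simp add: form_jet_def)
  next
    case (Suc j) then show ?case by (simp add: partial_has_partials[OF has_partials_form_jet])
  qed
  have "(partial_x ^^ i) (form_jet n a 0 j) = form_jet n a i j" for i j
    by (induction i) (simp_all add: partial_has_partials[OF has_partials_form_jet])
  then show ?thesis by (simp add: jet_at_def y)
qed

lemma entire2_form: "entire2 (form n a)"
proof -
  have "has_partials (form_jet n a 0 0) (form_jet n a 1 0) (form_jet n a 0 1)"
    using has_partials_form_jet[of n a 0 0] by simp
  then show ?thesis by (auto simp: entire2_def has_partials_def form_jet_def)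
qed

section \<open>Total derivatives\<close>

text \<open>The index set in a total derivative depends on the jet; it is traded for a fixed finite
  set \<open>S\<close> containing it, the additional terms being zero.\<close>

lemma total_derivative_sum:
  fixes g w :: "nat \<times> nat \<Rightarrow> complex"
  assumes "finite S" "\<And>i j. pd_u i j F p = g (i, j)" "\<And>k. k \<notin> S \<Longrightarrow> g k = 0"
  shows "(\<Sum>(i, j)\<in>{(i, j). pd_u i j F p \<noteq> 0}. h i j * pd_u i j F p) = (\<Sum>(i, j)\<in>S. h i j * g (i, j))"
  using assms by (intro sum.mono_neutral_cong_left) auto

lemma DERIV_if_replace: "((\<lambda>t. if P then t else A) has_field_derivative (if P then 1 else 0)) (at (t::complex))"
  by simp

text \<open>The Euler equation and all its total derivatives have this shape: each total derivative
  raises one index and, because of the explicit x or y, adds 1 to \<open>c\<close>. This makes the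
  iteration a plain induction.\<close>

definition linear_eq :: "nat \<Rightarrow> nat \<Rightarrow> complex \<Rightarrow> jet \<Rightarrow> complex" where
  "linear_eq k l c p = jet_x p * jet_u (Suc k) l p + jet_y p * jet_u k (Suc l) p + c * jet_u k l p"

lemma jet_u_update:
  "jet_u k l (x, y, u(i := (u i)(j := t))) = (if k = i \<and> l = j then t else u k l)"
  by (simp add: jet_u_def)

lemma pd_u_linear_eq:
  "pd_u i j (linear_eq k l c) (x, y, u) =
     x * (if Suc k = i \<and> l = j then 1 else 0) + y * (if k = i \<and> Suc l = j then 1 else 0)
     + c * (if k = i \<and> l = j then 1 else 0)"
  unfolding pd_u_def prod.case linear_eq_def jet_u_update jet_x_def jet_y_def
  by (intro DERIV_imp_deriv DERIV_add DERIV_cmult DERIV_if_replace)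

lemma total_linear_eq:
  "total_dx (linear_eq k l c) = linear_eq (Suc k) l (c + 1)"
  "total_dy (linear_eq k l c) = linear_eq k (Suc l) (c + 1)"
proof -
  have "total_dx (linear_eq k l c) p = linear_eq (Suc k) l (c + 1) p \<and>
    total_dy (linear_eq k l c) p = linear_eq k (Suc l) (c + 1) p" for p
  proof (cases p)
    case (fields x y u)
    have x: "pd_x (linear_eq k l c) (x, y, u) = u (Suc k) l"
      unfolding pd_x_def prod.case linear_eq_def jet_x_def jet_y_def jet_u_def
      by (rule DERIV_imp_deriv) (auto intro!: derivative_eq_intros)
    have y: "pd_y (linear_eq k l c) (x, y, u) = u k (Suc l)"
      unfolding pd_y_def prod.case linear_eq_def jet_x_def jet_y_def jet_u_def
      by (rule DERIV_imp_deriv) (auto intro!: derivative_eq_intros)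
    define g :: "nat \<times> nat \<Rightarrow> complex" where "g = (\<lambda>(i, j). 
      x * (if Suc k = i \<and> l = j then 1 else 0) + y * (if k = i \<and> Suc l = j then 1 else 0)
     + c * (if k = i \<and> l = j then 1 else 0))"
    let ?S = "{(Suc k, l), (k, Suc l), (k, l)}"
    have g: "pd_u i j (linear_eq k l c) (x, y, u) = g (i, j)" for i j
      by (simp add: pd_u_linear_eq g_def)
    have g0: "g q = 0" if "q \<notin> ?S" for q
      using that by (cases q) (auto simp: g_def)
    have S: "finite ?S" by simp
    have sums: "(\<Sum>(i, j)\<in>{(i, j). pd_u i j (linear_eq k l c) (x, y, u) \<noteq> 0}.
        h i j * pd_u i j (linear_eq k l c) (x, y, u)) = (\<Sum>(i, j)\<in>?S. h i j * g (i, j))" for h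
      by (rule total_derivative_sum[OF S g]) (rule g0)
    have "total_dx (linear_eq k l c) (x, y, u) =
        u (Suc k) l + (\<Sum>(i, j)\<in>?S. jet_u (i + 1) j (x, y, u) * g (i, j))"
      "total_dy (linear_eq k l c) (x, y, u) =
        u k (Suc l) + (\<Sum>(i, j)\<in>?S. jet_u i (j + 1) (x, y, u) * g (i, j))"
      unfolding total_dx_def total_dy_def x y by (simp_all only: sums add_0)
    then show ?thesis
      by (simp add: fields g_def linear_eq_def jet_x_def jet_y_def jet_u_def algebra_simps)
  qed
  then show "total_dx (linear_eq k l c) = linear_eq (Suc k) l (c + 1)"
    "total_dy (linear_eq k l c) = linear_eq k (Suc l) (c + 1)" by auto
qed

lemma iterated_total_euler4:
  "(total_dx ^^ k) ((total_dy ^^ l) euler4) = linear_eq k l (of_nat (k + l) - 4)"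
proof -
  have "euler4 = linear_eq 0 0 (- 4)"
    by (simp add: fun_eq_iff euler4_def linear_eq_def)
  then have "(total_dy ^^ l) euler4 = linear_eq 0 l (of_nat l - 4)"
    by (induction l) (simp_all add: total_linear_eq)
  then show ?thesis
    by (induction k) (simp_all add: total_linear_eq algebra_simps)
qed

text \<open>Euler's identity for a derivative of order \<open>k + l\<close>, itself a form of degree
  \<open>n - (k + l)\<close>. For \<open>n = 4\<close> the bound is the range
  \<open>k + l \<le> 3\<close> of \<open>E4\<close>.\<close>

lemma form_jet_euler:
  assumes "k + l < n"
  shows "v$1 * form_jet n a (Suc k) l v + v$2 * form_jet n a k (Suc l) v
     = (of_nat n - of_nat (k + l)) * form_jet n a k l v"
proof -
  obtain m where m: "n = Suc (m + k + l)"
    using assms by (metis add.assoc add.commute less_imp_Suc_add)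
  show ?thesis using euler_form[of v m "\<lambda>i. a (i + k)"] by (simp add: form_jet_def m)
qed

lemma E4_form:
  assumes "F \<in> E4" shows "F (jet_at (form 4 a) v) = 0"
proof -
  from assms consider k l where "k + l \<le> 3" "F = (total_dx ^^ k) ((total_dy ^^ l) euler4)"
    | i j where "i + j \<ge> 5" "F = jet_u i j" unfolding E4_def by blast
  then show ?thesis
  proof cases
    case 1
    then show ?thesis using form_jet_euler[of k l 4 v a]
      unfolding 1 iterated_total_euler4
      by (simp add: linear_eq_def jet_at_form jet_x_def jet_y_def jet_u_def algebra_simps)
  next
    case 2
    then show ?thesis by (simp add: jet_at_form jet_u_def form_jet_def)
  qed
qed

lemma pd_u_J2:
  "pd_u i j J2 (x, y, u) =
     ((if 2 = i \<and> 0 = j then 1 else 0) * u 0 2 + (if 0 = i \<and> 2 = j then 1 else 0) * u 2 0)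
     - 2 * u 1 1 * (if 1 = i \<and> 1 = j then 1 else 0)"
proof -
  have "((\<lambda>t. (if 2 = i \<and> 0 = j then t else u 2 0) * (if 0 = i \<and> 2 = j then t else u 0 2) -
      (if 1 = i \<and> 1 = j then t else u 1 1)\<^sup>2) has_field_derivative
     ((if 2 = i \<and> 0 = j then 1 else 0) * u 0 2 + (if 0 = i \<and> 2 = j then 1 else 0) * u 2 0)
     - 2 * u 1 1 * (if 1 = i \<and> 1 = j then 1 else 0)) (at (u i j))"
    by (auto intro!: derivative_eq_intros DERIV_if_replace)
  then show ?thesis
    unfolding pd_u_def prod.case J2_def jet_u_update by (rule DERIV_imp_deriv)
qed

text \<open>J3 is the Jacobian of the function and its Hessian J2; the total derivatives of J2 are
  expanded by the product rule.\<close>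

lemma J3_jet:
  "J3 (x, y, u) = u 1 0 * (u 2 1 * u 0 2 + u 2 0 * u 0 3 - 2 * u 1 1 * u 1 2)
    - u 0 1 * (u 3 0 * u 0 2 + u 2 0 * u 1 2 - 2 * u 1 1 * u 2 1)"
proof -
  define g :: "nat \<times> nat \<Rightarrow> complex" where "g = (\<lambda>(i, j). 
     ((if 2 = i \<and> 0 = j then 1 else 0) * u 0 2 + (if 0 = i \<and> 2 = j then 1 else 0) * u 2 0)
     - 2 * u 1 1 * (if 1 = i \<and> 1 = j then 1 else 0))"
  let ?S = "{(2, 0), (0, 2), (1, 1)} :: (nat \<times> nat) set"
  have g: "pd_u i j J2 (x, y, u) = g (i, j)" for i j
    by (simp add: pd_u_J2 g_def)
  have g0: "g q = 0" if "q \<notin> ?S" for q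
    using that by (cases q) (auto simp: g_def)
  have S: "finite ?S" by simp
  have sums: "(\<Sum>(i, j)\<in>{(i, j). pd_u i j J2 (x, y, u) \<noteq> 0}. h i j * pd_u i j J2 (x, y, u))
      = (\<Sum>(i, j)\<in>?S. h i j * g (i, j))" for h
    by (rule total_derivative_sum[OF S g]) (rule g0)
  have x: "pd_x J2 (x, y, u) = 0"
    unfolding pd_x_def prod.case J2_def jet_u_def by simp
  have y: "pd_y J2 (x, y, u) = 0"
    unfolding pd_y_def prod.case J2_def jet_u_def by simp
  have "total_dx J2 (x, y, u) = (\<Sum>(i, j)\<in>?S. jet_u (i + 1) j (x, y, u) * g (i, j))"
    "total_dy J2 (x, y, u) = (\<Sum>(i, j)\<in>?S. jet_u i (j + 1) (x, y, u) * g (i, j))"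
    unfolding total_dx_def total_dy_def x y by (simp_all only: sums add_0)
  then have "total_dx J2 (x, y, u) = u 3 0 * u 0 2 + u 2 0 * u 1 2 - 2 * u 1 1 * u 2 1"
    "total_dy J2 (x, y, u) = u 2 1 * u 0 2 + u 2 0 * u 0 3 - 2 * u 1 1 * u 1 2"
    by (simp_all add: g_def jet_u_def numeral_2_eq_2 numeral_3_eq_3)
  then show ?thesis
    by (simp add: J3_def nabla1_def jet_u_def)
qed

lemma J0_jet: "J0 (x, y, u) = u 0 0" and J2_jet: "J2 (x, y, u) = u 2 0 * u 0 2 - (u 1 1)\<^sup>2"
  by (simp_all add: J0_def J2_def jet_u_def)

section \<open>Covariance and the syzygy\<close>

lemma has_partials_unique:
  assumes "has_partials f p q" "has_partials f r s"
  shows "p = r" "q = s"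
  using partial_has_partials[OF assms(1)] partial_has_partials[OF assms(2)] by auto

text \<open>The form, its Hessian and their Jacobian are covariants: a substitution multiplies them
  by 1, the square and the cube of its determinant, which is 1 here.\<close>

lemma J_form_comp:
  fixes B :: "complex^2^2"
  assumes det: "det B = 1" and eq: "form n a' = form n a \<circ> (*v) B"
  shows "J0 (jet_at (form n a') v) = J0 (jet_at (form n a) (B *v v))"
    "J2 (jet_at (form n a') v) = J2 (jet_at (form n a) (B *v v))"
    "J3 (jet_at (form n a') v) = J3 (jet_at (form n a) (B *v v))"
proof -
  \<comment> \<open>\<open>U\<close> holds the derivatives of the substituted form, \<open>V\<close>
    those of the original form at the moved point. Starting from \<open>U 0 0 = V 0 0\<close>, the
    chain rule expresses \<open>U\<close> through \<open>V\<close> order by order.\<close>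
  define U where "U = form_jet n a'"
  define V where "V i j = (\<lambda>v. form_jet n a i j (B *v v))" for i j
  note U = has_partials_form_jet[of n a', folded U_def]
  have V: "has_partials (V i j) (\<lambda>v. B$1$1 * V (Suc i) j v + B$2$1 * V i (Suc j) v)
     (\<lambda>v. B$1$2 * V (Suc i) j v + B$2$2 * V i (Suc j) v)" for i j
    unfolding V_def by (rule has_partials_comp[OF has_partials_form_jet])
  have step: "has_partials (\<lambda>v. c * V i j v + d * V k l v)
     (\<lambda>v. c * (B$1$1 * V (Suc i) j v + B$2$1 * V i (Suc j) v) + d * (B$1$1 * V (Suc k) l v + B$2$1 * V k (Suc l) v))
     (\<lambda>v. c * (B$1$2 * V (Suc i) j v + B$2$2 * V i (Suc j) v) + d * (B$1$2 * V (Suc k) l v + B$2$2 * V k (Suc l) v))"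
    for c d i j k l
    by (rule has_partials_cmult_add[OF V V])
  have 00: "U 0 0 = V 0 0"
    using eq by (simp add: U_def V_def form_jet_def fun_eq_iff)
  let ?a = "B$1$1" and ?b = "B$1$2" and ?c = "B$2$1" and ?d = "B$2$2"
  have 1: "U 1 0 = (\<lambda>v. ?a * V 1 0 v + ?c * V 0 1 v)" "U 0 1 = (\<lambda>v. ?b * V 1 0 v + ?d * V 0 1 v)"
    using has_partials_unique[OF U[of 0 0, unfolded 00] V[of 0 0]] by simp_all
  have 2: "U 2 0 = (\<lambda>v. ?a * (?a * V 2 0 v + ?c * V 1 1 v) + ?c * (?a * V 1 1 v + ?c * V 0 2 v))"
    "U 1 1 = (\<lambda>v. ?a * (?b * V 2 0 v + ?d * V 1 1 v) + ?c * (?b * V 1 1 v + ?d * V 0 2 v))"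
    "U 0 2 = (\<lambda>v. ?b * (?b * V 2 0 v + ?d * V 1 1 v) + ?d * (?b * V 1 1 v + ?d * V 0 2 v))"
    using has_partials_unique[OF U[of 1 0, unfolded 1] step[of ?a 1 0 ?c 0 1]]
      has_partials_unique[OF U[of 0 1, unfolded 1] step[of ?b 1 0 ?d 0 1]]
    by (simp_all add: numeral_2_eq_2)
  have step3: "has_partials (\<lambda>v. c * (c' * V i j v + d' * V k l v) + d * (c' * V m n v + d' * V p q v))
     (\<lambda>v. c * (c' * (?a * V (Suc i) j v + ?c * V i (Suc j) v) + d' * (?a * V (Suc k) l v + ?c * V k (Suc l) v))
         + d * (c' * (?a * V (Suc m) n v + ?c * V m (Suc n) v) + d' * (?a * V (Suc p) q v + ?c * V p (Suc q) v)))
     (\<lambda>v. c * (c' * (?b * V (Suc i) j v + ?d * V i (Suc j) v) + d' * (?b * V (Suc k) l v + ?d * V k (Suc l) v))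
         + d * (c' * (?b * V (Suc m) n v + ?d * V m (Suc n) v) + d' * (?b * V (Suc p) q v + ?d * V p (Suc q) v)))"
    for c d c' d' i j k l m n p q
    by (rule has_partials_cmult_add[OF step step])
  \<comment> \<open>The third derivative as a symmetric trilinear form, evaluated at
    \<open>(p, q)\<close>, \<open>(r, s)\<close>, \<open>(t, w)\<close>; the columns of
    \<open>B\<close> are inserted below.\<close>
  let ?third = "\<lambda>p q r s t w v. p * (r * (t * V 3 0 v + w * V 2 1 v) + s * (t * V 2 1 v + w * V 1 2 v))
      + q * (r * (t * V 2 1 v + w * V 1 2 v) + s * (t * V 1 2 v + w * V 0 3 v))"
  have 3: "U 3 0 = ?third ?a ?c ?a ?c ?a ?c" "U 2 1 = ?third ?a ?c ?a ?c ?b ?d"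
    "U 1 2 = ?third ?b ?d ?b ?d ?a ?c" "U 0 3 = ?third ?b ?d ?b ?d ?b ?d"
    using has_partials_unique[OF U[of 2 0, unfolded 2] step3[of ?a ?a 2 0 ?c 1 1 ?c 1 1 0 2]]
      has_partials_unique[OF U[of 0 2, unfolded 2] step3[of ?b ?b 2 0 ?d 1 1 ?d 1 1 0 2]]
    by (simp_all add: numeral_2_eq_2 numeral_3_eq_3)
  have d: "?a * ?d - ?b * ?c = 1" using det by (simp add: det_2)
  have jets: "jet_at (form n a') v = (v$1, v$2, \<lambda>i j. U i j v)"
    "jet_at (form n a) (B *v v) = ((B *v v)$1, (B *v v)$2, \<lambda>i j. V i j v)"
    by (simp_all add: jet_at_form U_def V_def)
  show "J0 (jet_at (form n a') v) = J0 (jet_at (form n a) (B *v v))"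
    unfolding jets J0_jet 00 ..
  have "U 2 0 v * U 0 2 v - (U 1 1 v)\<^sup>2 = (?a * ?d - ?b * ?c)\<^sup>2 * (V 2 0 v * V 0 2 v - (V 1 1 v)\<^sup>2)"
    unfolding 2 by algebra
  then show "J2 (jet_at (form n a') v) = J2 (jet_at (form n a) (B *v v))"
    unfolding jets J2_jet d by simp
  have "U 1 0 v * (U 2 1 v * U 0 2 v + U 2 0 v * U 0 3 v - 2 * U 1 1 v * U 1 2 v)
    - U 0 1 v * (U 3 0 v * U 0 2 v + U 2 0 v * U 1 2 v - 2 * U 1 1 v * U 2 1 v)
   = (?a * ?d - ?b * ?c)^3 * (V 1 0 v * (V 2 1 v * V 0 2 v + V 2 0 v * V 0 3 v - 2 * V 1 1 v * V 1 2 v)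
    - V 0 1 v * (V 3 0 v * V 0 2 v + V 2 0 v * V 1 2 v - 2 * V 1 1 v * V 2 1 v))"
    unfolding 1 2 3 by algebra
  then show "J3 (jet_at (form n a') v) = J3 (jet_at (form n a) (B *v v))"
    unfolding jets J3_jet d by simp
qed

section \<open>Explicit covariants of a quartic and their syzygy\<close>

lemma form_4: "form 4 a v = a 0 * v$2^4 / 24 + a 1 * v$1 * v$2^3 / 6 + a 2 * v$1^2 * v$2^2 / 4
   + a 3 * v$1^3 * v$2 / 6 + a 4 * v$1^4 / 24"
  and form_3: "form 3 a v = a 0 * v$2^3 / 6 + a 1 * v$1 * v$2^2 / 2 + a 2 * v$1^2 * v$2 / 2 + a 3 * v$1^3 / 6"
  and form_2: "form 2 a v = a 0 * v$2^2 / 2 + a 1 * v$1 * v$2 + a 2 * v$1^2 / 2"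
  and form_1: "form 1 a v = a 0 * v$2 + a 1 * v$1"
  by (simp_all add: form_def numeral_eq_Suc fact_Suc)

lemma J_form_4:
  fixes a v
  defines "x \<equiv> v$1" and "y \<equiv> v$2"
  defines "u20 \<equiv> a 2 * y^2 / 2 + a 3 * x * y + a 4 * x^2 / 2"
    and "u11 \<equiv> a 1 * y^2 / 2 + a 2 * x * y + a 3 * x^2 / 2"
    and "u02 \<equiv> a 0 * y^2 / 2 + a 1 * x * y + a 2 * x^2 / 2"
  shows "J0 (jet_at (form 4 a) v) = form 4 a v"
    "J2 (jet_at (form 4 a) v) = u20 * u02 - u11^2"
    "J3 (jet_at (form 4 a) v) = 
      (a 1 * y^3 / 6 + a 2 * x * y^2 / 2 + a 3 * x^2 * y / 2 + a 4 * x^3 / 6) *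
        ((a 2 * y + a 3 * x) * u02 + u20 * (a 0 * y + a 1 * x) - 2 * u11 * (a 1 * y + a 2 * x))
      - (a 0 * y^3 / 6 + a 1 * x * y^2 / 2 + a 2 * x^2 * y / 2 + a 3 * x^3 / 6) *
        ((a 3 * y + a 4 * x) * u02 + u20 * (a 1 * y + a 2 * x) - 2 * u11 * (a 2 * y + a 3 * x))"
proof -
  have j: "form_jet 4 a 0 0 v = form 4 a v" "form_jet 4 a 2 0 v = u20" "form_jet 4 a 1 1 v = u11" "form_jet 4 a 0 2 v = u02"
    "form_jet 4 a 1 0 v = a 1 * y^3 / 6 + a 2 * x * y^2 / 2 + a 3 * x^2 * y / 2 + a 4 * x^3 / 6"
    "form_jet 4 a 0 1 v = a 0 * y^3 / 6 + a 1 * x * y^2 / 2 + a 2 * x^2 * y / 2 + a 3 * x^3 / 6"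
    "form_jet 4 a 3 0 v = a 3 * y + a 4 * x" "form_jet 4 a 2 1 v = a 2 * y + a 3 * x"
    "form_jet 4 a 1 2 v = a 1 * y + a 2 * x" "form_jet 4 a 0 3 v = a 0 * y + a 1 * x"
    by (simp_all add: form_jet_def form_3 form_2 form_1[unfolded One_nat_def] assms flip: numeral_2_eq_2 numeral_3_eq_3)
  show "J0 (jet_at (form 4 a) v) = form 4 a v"
    unfolding jet_at_form J0_jet j ..
  show "J2 (jet_at (form 4 a) v) = u20 * u02 - u11^2"
    unfolding jet_at_form J2_jet j ..
  show "J3 (jet_at (form 4 a) v) = 
      (a 1 * y^3 / 6 + a 2 * x * y^2 / 2 + a 3 * x^2 * y / 2 + a 4 * x^3 / 6) *
        ((a 2 * y + a 3 * x) * u02 + u20 * (a 0 * y + a 1 * x) - 2 * u11 * (a 1 * y + a 2 * x))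
      - (a 0 * y^3 / 6 + a 1 * x * y^2 / 2 + a 2 * x^2 * y / 2 + a 3 * x^3 / 6) *
        ((a 3 * y + a 4 * x) * u02 + u20 * (a 1 * y + a 2 * x) - 2 * u11 * (a 2 * y + a 3 * x))"
    unfolding jet_at_form J3_jet j ..
qed

text \<open>Every term of the equation has degree 12 in the point, so on a coordinate axis a power
  of the coordinate splits off and an identity between coefficients remains.\<close>

lemma ode_homogeneous:
  fixes k h c z \<alpha> \<delta> :: complex
  shows "9 * (k * z^6 / 12)^2 + 16 * (h * z^4 / 4)^3 + 144 * \<alpha> * (c * z^4 / 24)^2 * (h * z^4 / 4)
    + 864 * \<delta> * (c * z^4 / 24)^3 = z^12 / 16 * (k^2 + 4 * h^3 + \<alpha> * c^2 * h + \<delta> * c^3)"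
  by (simp add: power_mult_distrib power_divide flip: power_mult) (simp add: algebra_simps flip: power_add)

text \<open>The classical relation between the covariants of a quartic: \<open>\<alpha>\<close> is
  minus its quadratic invariant, \<open>\<delta>\<close> its catalecticant. Both are unchanged by
  shears, and a shear moves any point with nonzero x to the x-axis, which keeps the polynomial
  identities small.\<close>

lemma quartic_syzygy:
  fixes x y b0 b1 b2 b3 b4 :: complex
  defines "f \<equiv> b0 * y^4 / 24 + b1 * x * y^3 / 6 + b2 * x^2 * y^2 / 4 + b3 * x^3 * y / 6 + b4 * x^4 / 24"
    and "u20 \<equiv> b2 * y^2 / 2 + b3 * x * y + b4 * x^2 / 2"
    and "u11 \<equiv> b1 * y^2 / 2 + b2 * x * y + b3 * x^2 / 2"
    and "u02 \<equiv> b0 * y^2 / 2 + b1 * x * y + b2 * x^2 / 2"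
    and "u10 \<equiv> b1 * y^3 / 6 + b2 * x * y^2 / 2 + b3 * x^2 * y / 2 + b4 * x^3 / 6"
    and "u01 \<equiv> b0 * y^3 / 6 + b1 * x * y^2 / 2 + b2 * x^2 * y / 2 + b3 * x^3 / 6"
  defines "J \<equiv> u10 * ((b2 * y + b3 * x) * u02 + u20 * (b0 * y + b1 * x) - 2 * u11 * (b1 * y + b2 * x))
      - u01 * ((b3 * y + b4 * x) * u02 + u20 * (b1 * y + b2 * x) - 2 * u11 * (b2 * y + b3 * x))"
    and "H \<equiv> u20 * u02 - u11^2"
    and "\<alpha> \<equiv> 4 * b1 * b3 - b4 * b0 - 3 * b2^2"
    and "\<delta> \<equiv> b2 * b4 * b0 - b0 * b3^2 - b4 * b1^2 + 2 * b1 * b2 * b3 - b2 ^ 3"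
  shows "9 * J^2 + 16 * H ^ 3 + 144 * \<alpha> * f^2 * H + 864 * \<delta> * f ^ 3 = 0"
\<comment> \<open>On the y-axis the slope \<open>y / x\<close> of the shear is undefined, but the
  form can be evaluated there directly.\<close>
proof (cases "x = 0")
  case True
  have jets: "f = b0 * y^4 / 24" "u01 = b0 * y^3 / 6" "u10 = b1 * y^3 / 6"
    "u02 = b0 * y^2 / 2" "u11 = b1 * y^2 / 2" "u20 = b2 * y^2 / 2"
    by (simp_all add: f_def u20_def u11_def u02_def u10_def u01_def True)
  have "J = (3 * b0 * b1 * b2 - 2 * b1^3 - b0^2 * b3) * y^6 / 12" "H = (b2 * b0 - b1^2) * y^4 / 4"
    unfolding J_def H_def jets True by (simp_all add: field_simps eval_nat_numeral)
  then have "9 * J^2 + 16 * H ^ 3 + 144 * \<alpha> * f^2 * H + 864 * \<delta> * f ^ 3 = y^12 / 16 * 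
      ((3 * b0 * b1 * b2 - 2 * b1^3 - b0^2 * b3)^2 + 4 * (b2 * b0 - b1^2)^3 + \<alpha> * b0^2 * (b2 * b0 - b1^2) + \<delta> * b0^3)"
    unfolding jets by (simp only: ode_homogeneous)
  moreover have "(3 * b0 * b1 * b2 - 2 * b1^3 - b0^2 * b3)^2 + 4 * (b2 * b0 - b1^2)^3
      + \<alpha> * b0^2 * (b2 * b0 - b1^2) + \<delta> * b0^3 = 0"
    unfolding \<alpha>_def \<delta>_def by algebra
  ultimately show ?thesis by simp
next
  case False
  \<comment> \<open>The shear taking \<open>(x, y)\<close> to \<open>(x, 0)\<close>; the \<open>c\<close> are the coefficients of the sheared form.\<close>
  define t where "t = y / x"
  define c0 c1 c2 c3 c4 where "c0 = b0" and "c1 = b1 + t * b0" and "c2 = b2 + 2 * t * b1 + t^2 * b0"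
    and "c3 = b3 + 3 * t * b2 + 3 * t^2 * b1 + t^3 * b0"
    and "c4 = b4 + 4 * t * b3 + 6 * t^2 * b2 + 4 * t^3 * b1 + t^4 * b0"
  note c = c0_def c1_def c2_def c3_def c4_def
  have y: "y = t * x" using False by (simp add: t_def)
  have b: "b0 = c0" "b1 = c1 - t * c0" "b2 = c2 - 2 * t * c1 + t^2 * c0"
    "b3 = c3 - 3 * t * c2 + 3 * t^2 * c1 - t^3 * c0"
    "b4 = c4 - 4 * t * c3 + 6 * t^2 * c2 - 4 * t^3 * c1 + t^4 * c0"
    unfolding c by - (algebra+)
  have inv: "\<alpha> = 4 * c1 * c3 - c4 * c0 - 3 * c2^2"
    "\<delta> = c2 * c4 * c0 - c0 * c3^2 - c4 * c1^2 + 2 * c1 * c2 * c3 - c2 ^ 3"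
    unfolding \<alpha>_def \<delta>_def b by - (algebra+)
  have jets: "f = c4 * x^4 / 24" "u01 = c3 * x^3 / 6" "u10 = (c4 - t * c3) * x^3 / 6"
    "u02 = c2 * x^2 / 2" "u11 = (c3 - t * c2) * x^2 / 2" "u20 = (c4 - 2 * t * c3 + t^2 * c2) * x^2 / 2"
    "b0 * y + b1 * x = c1 * x" "b1 * y + b2 * x = (c2 - t * c1) * x"
    "b2 * y + b3 * x = (c3 - 2 * t * c2 + t^2 * c1) * x"
    "b3 * y + b4 * x = (c4 - 3 * t * c3 + 3 * t^2 * c2 - t^3 * c1) * x"
    unfolding f_def u20_def u11_def u02_def u10_def u01_def b y
    by (simp_all add: field_simps eval_nat_numeral)
  \<comment> \<open>The slope \<open>t\<close> cancels: this is the invariance of Hessian and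
    Jacobian under shears. What remains are the leading coefficients of these covariants.\<close>
  have "J = (c4^2 * c1 + 2 * c3^3 - 3 * c2 * c3 * c4) * x^6 / 12" "H = (c2 * c4 - c3^2) * x^4 / 4"
    unfolding J_def H_def jets by (simp_all add: field_simps eval_nat_numeral)
  then have "9 * J^2 + 16 * H ^ 3 + 144 * \<alpha> * f^2 * H + 864 * \<delta> * f ^ 3 = x^12 / 16 * 
      ((c4^2 * c1 + 2 * c3^3 - 3 * c2 * c3 * c4)^2 + 4 * (c2 * c4 - c3^2)^3 + \<alpha> * c4^2 * (c2 * c4 - c3^2) + \<delta> * c4^3)"
    unfolding jets by (simp only: ode_homogeneous)
  moreover have "(c4^2 * c1 + 2 * c3^3 - 3 * c2 * c3 * c4)^2 + 4 * (c2 * c4 - c3^2)^3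
     + \<alpha> * c4^2 * (c2 * c4 - c3^2) + \<delta> * c4^3 = 0"
    unfolding inv by algebra
  ultimately show ?thesis by simp
qed

section \<open>Linear substitutions in forms and the space of quartics\<close>

lemma form_add: "form n a v + form n a' v = form n (\<lambda>i. a i + a' i) v"
  by (simp only: form_def distrib_right sum.distrib)

lemma form_cmult: "c * form n a v = form n (\<lambda>i. c * a i) v"
  by (simp add: form_def sum_distrib_left mult.assoc)

lemma form_sum: "(\<Sum>k\<in>K. form n (a k) v) = form n (\<lambda>i. \<Sum>k\<in>K. a k i) v"
  unfolding form_def by (subst sum.swap) (simp only: sum_distrib_right)

text \<open>Multiplying divided powers by x or y shifts the index and brings in the factors
  \<open>i\<close> and \<open>Suc n - i\<close>. These vanish at the two ends, where
  \<open>a (i - 1)\<close> and \<open>a i\<close> stand for no coefficient of the form.\<close>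

lemma linear_mult_form:
  "(p * v$1 + q * v$2) * form n a v = form (Suc n) (\<lambda>i. p * (of_nat i * a (i - 1)) + q * (of_nat (Suc n - i) * a i)) v"
proof -
  have "form (Suc n) (\<lambda>i. of_nat i * a (i - 1)) v = v$1 * form n a v"
    unfolding form_def sum_distrib_left
    by (subst sum.atMost_Suc_shift) (auto intro!: sum.cong simp: field_simps simp del: of_nat_Suc)
  moreover have "form (Suc n) (\<lambda>i. of_nat (Suc n - i) * a i) v = v$2 * form n a v"
    unfolding form_def sum_distrib_left sum.atMost_Suc
    by (auto intro!: sum.cong simp: field_simps Suc_diff_le simp del: of_nat_Suc)
  moreover have "form (Suc n) (\<lambda>i. p * (of_nat i * a (i - 1)) + q * (of_nat (Suc n - i) * a i)) v =
     p * form (Suc n) (\<lambda>i. of_nat i * a (i - 1)) v + q * form (Suc n) (\<lambda>i. of_nat (Suc n - i) * a i) v"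
    by (simp only: form_cmult form_add)
  ultimately show ?thesis by (simp add: algebra_simps)
qed

text \<open>Each monomial turns into a product of \<open>n\<close> linear forms, which is built up
  one linear factor at a time.\<close>

lemma form_comp_linear: "form n a \<circ> (*v) B \<in> range (form n)"
proof -
  define L :: "2 \<Rightarrow> complex^2 \<Rightarrow> complex" where "L j v = B$j$1 * v$1 + B$j$2 * v$2" for j v
  have *: "\<exists>a. \<forall>v. L 1 v ^ i * L 2 v ^ j = form (i + j) a v" for i j
  proof (induction i)
    case 0
    show ?case
    proof (induction j)
      case 0 then show ?case by (auto simp: form_0 intro: exI[of _ "\<lambda>_. 1"])
    next
      case (Suc j)
      then obtain a where "\<And>v. L 1 v ^ 0 * L 2 v ^ j = form (0 + j) a v" by blast
      then show ?case unfolding L_def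
        by (auto simp: linear_mult_form simp del: of_nat_Suc)
    qed
  next
    case (Suc i)
    then obtain a where "\<And>v. L 1 v ^ i * L 2 v ^ j = form (i + j) a v" by blast
    then show ?case unfolding L_def
      by (auto simp: linear_mult_form mult.assoc simp del: of_nat_Suc)
  qed
  have "\<exists>a. \<forall>v. L 1 v ^ i * L 2 v ^ (n - i) = form n a v" if "i \<le> n" for i
    using *[of i "n - i"] that by simp
  then obtain m where m: "\<And>i v. i \<le> n \<Longrightarrow> L 1 v ^ i * L 2 v ^ (n - i) = form n (m i) v"
    by metis
  have "form n a (B *v v) = (\<Sum>i\<le>n. a i / (fact i * fact (n - i)) * (L 1 v ^ i * L 2 v ^ (n - i)))" for v
    by (simp add: form_def matrix2_mult L_def mult.assoc)
  also have "\<dots> v = (\<Sum>i\<le>n. form n (\<lambda>k. a i / (fact i * fact (n - i)) * m i k) v)" for v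
    by (intro sum.cong refl) (simp add: m form_cmult)
  also have "\<dots> v = form n (\<lambda>k. \<Sum>i\<le>n. a i / (fact i * fact (n - i)) * m i k) v" for v
    by (rule form_sum)
  finally show ?thesis by (auto simp: fun_eq_iff)
qed

text \<open>A right inverse to reading off coordinates in \<open>quartic_of\<close>. The indices are
  numbers modulo 5, so the last branch is the index 4.\<close>

definition coeff_vec :: "(nat \<Rightarrow> complex) \<Rightarrow> complex^5" where
  "coeff_vec a = (\<chi> i. if i = 0 then a 0 else if i = 1 then a 1 else if i = 2 then a 2
        else if i = 3 then a 3 else a 4)"

lemma quartic_of_coeff_vec: "quartic_of (coeff_vec a) = form 4 a"
  by (simp add: fun_eq_iff quartic_of_def binary_quartic_form form_4 coeff_vec_def)

lemma range_quartic_of: "range quartic_of = range (form 4)"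
proof -
  have "form 4 a \<in> range quartic_of" for a
    by (metis quartic_of_coeff_vec rangeI)
  then show ?thesis by (auto simp: quartic_of_def binary_quartic_form)
qed

lemma orbit_form:
  assumes "g \<in> SL2_orbit (form 4 a)"
  obtains a' where "g = form 4 a'"
  using assms form_comp_linear[of 4 a] by (auto simp: SL2_orbit_eq image_iff)

lemma regular_imp_form:
  assumes "regular f"
  obtains a where "f = form 4 a"
proof -
  have "f \<in> range quartic_of" using assms unfolding regular_def by (rule conjunct1)
  then show ?thesis using that unfolding range_quartic_of by blast
qed

text \<open>Apart from membership in \<open>range quartic_of\<close>, regularity refers only to the
  orbit, which \<open>f\<close> and \<open>g\<close> share.\<close>

lemma regular_orbit:
  assumes "regular f" "g \<in> SL2_orbit f" shows "regular g"
proof -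
  obtain a where "f = form 4 a" using regular_imp_form[OF assms(1)] .
  then obtain a' where "g = form 4 a'" using orbit_form assms(2) by metis
  then have "g \<in> range quartic_of" using range_quartic_of by blast
  then show ?thesis using assms(1) SL2_orbit_cong[OF assms(2)] unfolding regular_def by simp
qed

section \<open>The third order equation along an orbit\<close>

definition solves_ode :: "complex \<Rightarrow> complex \<Rightarrow> (complex^2 \<Rightarrow> complex) \<Rightarrow> bool" where
  "solves_ode \<alpha> \<delta> f \<longleftrightarrow> (\<forall>v. quartic_ode \<alpha> \<delta> (jet_at f v) = 0)"

text \<open>Quartic forms are entire and satisfy \<open>E4\<close>, which leaves the third order
  equation alone.\<close>

lemma is_solution_form:
  "is_solution (insert (quartic_ode \<alpha> \<delta>) E4) (form 4 a) \<longleftrightarrow> solves_ode \<alpha> \<delta> (form 4 a)"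
  using E4_form by (auto simp: is_solution_def solves_ode_def entire2_form)

text \<open>By covariance J0, J2 and J3 of \<open>g\<close> at \<open>v\<close> are those of the
  given form at the moved point, and the equation involves nothing else.\<close>

lemma solves_ode_orbit:
  assumes "solves_ode \<alpha> \<delta> (form 4 a)" "g \<in> SL2_orbit (form 4 a)"
  shows "solves_ode \<alpha> \<delta> g"
proof -
  obtain a' where g: "g = form 4 a'" using orbit_form[OF assms(2)] .
  obtain B where "g = form 4 a \<circ> (*v) B" "det B = 1" using assms(2) by (auto simp: SL2_orbit_eq)
  then show ?thesis
    using assms(1) J_form_comp[of B 4 a' a] unfolding g solves_ode_def quartic_ode_def by metis
qed

lemma solves_ode_own_invariants:
  "solves_ode (4 * a 1 * a 3 - a 4 * a 0 - 3 * (a 2)^2)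
    (a 2 * a 4 * a 0 - a 0 * (a 3)^2 - a 4 * (a 1)^2 + 2 * a 1 * a 2 * a 3 - a 2 ^ 3) (form 4 a)"
  unfolding solves_ode_def quartic_ode_def J_form_4 form_4 by (intro allI quartic_syzygy)

section \<open>Normal forms\<close>

text \<open>Plain monomial coefficients, better suited to explicit substitutions than divided
  powers; \<open>coeffs5\<close> translates between the two.\<close>

definition quartic :: "complex \<Rightarrow> complex \<Rightarrow> complex \<Rightarrow> complex \<Rightarrow> complex \<Rightarrow> complex^2 \<Rightarrow> complex" where
  "quartic c0 c1 c2 c3 c4 v =
     c0 * v$2^4 + c1 * v$1 * v$2^3 + c2 * v$1^2 * v$2^2 + c3 * v$1^3 * v$2 + c4 * v$1^4"

definition coeffs5 :: "complex \<Rightarrow> complex \<Rightarrow> complex \<Rightarrow> complex \<Rightarrow> complex \<Rightarrow> nat \<Rightarrow> complex" where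
  "coeffs5 c0 c1 c2 c3 c4 i = [24 * c0, 6 * c1, 4 * c2, 6 * c3, 24 * c4] ! i"

lemma coeffs5_simps [simp]:
  "coeffs5 c0 c1 c2 c3 c4 0 = 24 * c0" "coeffs5 c0 c1 c2 c3 c4 1 = 6 * c1" "coeffs5 c0 c1 c2 c3 c4 (Suc 0) = 6 * c1"
  "coeffs5 c0 c1 c2 c3 c4 2 = 4 * c2" "coeffs5 c0 c1 c2 c3 c4 3 = 6 * c3" "coeffs5 c0 c1 c2 c3 c4 4 = 24 * c4"
  by (simp_all add: coeffs5_def)

lemma quartic_form: "quartic c0 c1 c2 c3 c4 = form 4 (coeffs5 c0 c1 c2 c3 c4)"
  by (simp add: fun_eq_iff quartic_def form_4)

lemma form_quartic: "form 4 a = quartic (a 0 / 24) (a 1 / 6) (a 2 / 4) (a 3 / 6) (a 4 / 24)"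
  by (simp add: fun_eq_iff quartic_def form_4)

text \<open>Replacing y by \<open>y + s x\<close> gives the Taylor coefficients at \<open>s\<close>
  of the polynomial obtained by setting x to 1. In particular the x^4 coefficient vanishes when
  \<open>s\<close> is a root.\<close>

lemma quartic_shear:
  "quartic c0 (c1 + 4 * s * c0) (c2 + 3 * s * c1 + 6 * s^2 * c0) (c3 + 2 * s * c2 + 3 * s^2 * c1 + 4 * s^3 * c0)
     (c4 + s * c3 + s^2 * c2 + s^3 * c1 + s^4 * c0) \<in> SL2_orbit (quartic c0 c1 c2 c3 c4)"
  \<comment> \<open>The instantiation follows the order \<open>a\<close>, \<open>d\<close>,
    \<open>b\<close>, \<open>c\<close> of the determinant condition.\<close>
  by (rule substitution_in_orbit[of 1 1 0 s]) (simp, simp only: quartic_def vector_2, algebra)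

lemma quartic_scale:
  assumes "r \<noteq> 0"
  shows "quartic (c0 / r^4) (c1 / r^2) c2 (c3 * r^2) (c4 * r^4) \<in> SL2_orbit (quartic c0 c1 c2 c3 c4)"
  by (rule substitution_in_orbit[of r "1/r" 0 0])
     (use assms in \<open>simp_all add: quartic_def field_simps eval_nat_numeral\<close>)

lemma quartic_swap: "quartic c4 (- c3) c2 (- c1) c0 \<in> SL2_orbit (quartic c0 c1 c2 c3 c4)"
  by (rule substitution_in_orbit[of 0 0 1 "-1"]) (simp_all add: quartic_def)

text \<open>The linear factor x occurs exactly once. A shear removes the second coefficient of the
  cubic cofactor, and scaling by a square root of \<open>c1\<close> makes its leading coefficient
  1.\<close>

lemma quartic_normal_form_simple_root:
  assumes "c1 \<noteq> 0"
  shows "\<exists>p q. quartic 0 1 0 p q \<in> SL2_orbit (quartic 0 c1 c2 c3 c4)"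
proof -
  define s where "s = - c2 / (3 * c1)"
  obtain p q where 1: "quartic 0 c1 (c2 + 3 * s * c1) p q \<in> SL2_orbit (quartic 0 c1 c2 c3 c4)"
    using quartic_shear[of 0 c1 s c2 c3 c4] by auto
  have s: "c2 + 3 * s * c1 = 0" using assms by (simp add: s_def)
  have "csqrt c1 \<noteq> 0" using assms by simp
  from quartic_scale[OF this, of 0 c1 0 p q] assms
  have "quartic 0 1 0 (p * c1) (q * csqrt c1 ^ 4) \<in> SL2_orbit (quartic 0 c1 0 p q)" by simp
  then show ?thesis using SL2_orbit_trans[OF 1] s by auto
qed

text \<open>The shear by a root kills the x^4 coefficient, and the swap moves this zero to
  y^4.\<close>

lemma quartic_exists_root:
  "\<exists>d1 d2 d3 d4. quartic 0 d1 d2 d3 d4 \<in> SL2_orbit (quartic c0 c1 c2 c3 c4)"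
proof (cases "c0 = 0")
  case True
  then show ?thesis using SL2_orbit_refl by blast
next
  case False
  define P where "P = [:c4, c3, c2, c1, c0:]"
  have "degree P = 4" using False by (simp add: P_def)
  then have "\<not> constant (poly P)" by (simp add: constant_degree)
  then obtain s where s: "poly P s = 0" using fundamental_theorem_of_algebra by blast
  have s: "c4 + s * c3 + s^2 * c2 + s^3 * c1 + s^4 * c0 = 0"
    using s by (simp add: P_def) algebra
  show ?thesis
    using SL2_orbit_trans[OF quartic_shear[of c0 c1 s c2 c3 c4] quartic_swap] unfolding s by blast
qed

lemma quartic_normal_form:
  "(\<exists>p q. quartic 0 1 0 p q \<in> SL2_orbit (quartic c0 c1 c2 c3 c4)) \<or>
   (\<exists>c. quartic 0 0 c 0 0 \<in> SL2_orbit (quartic c0 c1 c2 c3 c4)) \<or>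
   (\<exists>c. quartic 0 0 0 0 c \<in> SL2_orbit (quartic c0 c1 c2 c3 c4))"
proof -
  let ?O = "SL2_orbit (quartic c0 c1 c2 c3 c4)"
  have good: ?thesis if "quartic 0 d1 d2 d3 d4 \<in> ?O" "d1 \<noteq> 0" for d1 d2 d3 d4
    using quartic_normal_form_simple_root[OF that(2)] SL2_orbit_trans[OF that(1)] by blast
  obtain d1 d2 d3 d4 where d: "quartic 0 d1 d2 d3 d4 \<in> ?O" using quartic_exists_root by blast
  \<comment> \<open>The cases are multiplicity 1, 2, 3 of the factor x, and lastly multiplicity 4 or
    the zero form.\<close>
  consider "d1 \<noteq> 0" | "d1 = 0" "d2 \<noteq> 0" | "d1 = 0" "d2 = 0" "d3 \<noteq> 0" | "d1 = 0" "d2 = 0" "d3 = 0" by blast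
  then show ?thesis
  proof cases
    case 1 then show ?thesis using good d by blast
  next
    case 2
    define s where "s = - d3 / (2 * d2)"
    define q where "q = d4 + s * d3 + s^2 * d2"
    have "d3 + 2 * s * d2 = 0" using 2 by (simp add: s_def)
    then have e: "quartic 0 0 d2 0 q \<in> ?O"
      using SL2_orbit_trans[OF d quartic_shear[of 0 d1 s d2 d3 d4]] 2 by (simp add: q_def)
    show ?thesis
    proof (cases "q = 0")
      case True then show ?thesis using e by blast
    next
      case False
      \<comment> \<open>After completing the square the form is \<open>x^2 (d2 y^2 + q x^2)\<close>.
        For nonzero \<open>q\<close> the number \<open>t\<close> is a simple root of the second
        factor; a shear and the swap bring it to the position required by
        \<open>good\<close>.\<close>
      define t where "t = csqrt (- q / d2)"
      have t: "t^2 * d2 = - q" "t \<noteq> 0" using 2 False by (simp_all add: t_def)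
      then have "quartic 0 0 d2 (2 * t * d2) 0 \<in> ?O"
        using SL2_orbit_trans[OF e quartic_shear[of 0 0 t d2 0 q]] by simp
      from SL2_orbit_trans[OF this quartic_swap] show ?thesis using good 2 t by auto
    qed
  next
    case 3
    \<comment> \<open>The form is \<open>x^3 (d3 y + d4 x)\<close>, whose linear cofactor provides
      the simple root.\<close>
    define s where "s = - d4 / d3"
    have "d4 + s * d3 = 0" using 3 by (simp add: s_def)
    then have "quartic 0 0 0 d3 0 \<in> ?O"
      using SL2_orbit_trans[OF d quartic_shear[of 0 d1 s d2 d3 d4]] 3 by simp
    from SL2_orbit_trans[OF this quartic_swap] show ?thesis using good 3 by auto
  next
    case 4 then show ?thesis using d by blast
  qed
qed

section \<open>Non-regular quartics\<close>

lemma continuous_poly_fun: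
  assumes "poly_fun p" shows "isCont p c"
  using assms by induction (auto intro!: continuous_intros)

text \<open>A rational invariant is constant along the approximating sequence, so by continuity its value there
  is the value at the limit.\<close>

lemma regular_orbit_of_equivalent_sequence:
  assumes reg: "regular (quartic_of c)" and lim: "\<gamma> \<longlonglongrightarrow> c"
    and equiv: "\<And>m n. quartic_of (\<gamma> m) \<in> SL2_orbit (quartic_of (\<gamma> n))"
  shows "\<exists>n. quartic_of (\<gamma> n) \<in> SL2_orbit (quartic_of c)"
proof -
  let ?O = "quartic_of -` SL2_orbit (quartic_of c)"
  obtain p1 q1 p2 q2 U c1 c2 where inv: "rational_invariant p1 q1" "rational_invariant p2 q2"
    and U: "open U" "?O \<subseteq> U" "\<And>c. c \<in> U \<Longrightarrow> q1 c \<noteq> 0 \<and> q2 c \<noteq> 0"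
    and O: "?O = {c. q1 c \<noteq> 0 \<and> q2 c \<noteq> 0 \<and> p1 c / q1 c = c1 \<and> p2 c / q2 c = c2}"
    using reg unfolding regular_def by blast
  have c: "c \<in> ?O" using SL2_orbit_refl by auto
  then have "\<forall>\<^sub>F n in sequentially. \<gamma> n \<in> U"
    using U lim by (auto intro: topological_tendstoD)
  \<comment> \<open>From \<open>N\<close> on the sequence stays in \<open>U\<close>, where the
    denominators are nonzero and invariance can be applied.\<close>
  then obtain N where N: "\<And>n. n \<ge> N \<Longrightarrow> \<gamma> n \<in> U" by (auto simp: eventually_sequentially)
  have val: "p (\<gamma> N) / q (\<gamma> N) = p c / q c"
    if inv: "rational_invariant p q" and q: "\<And>c. c \<in> U \<Longrightarrow> q c \<noteq> 0" for p q
  proof -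
    have "p (\<gamma> N) / q (\<gamma> N) = p (\<gamma> n) / q (\<gamma> n)" if "n \<ge> N" for n
    proof -
      obtain A where "A \<in> SL2" "quartic_of (\<gamma> n) = act A (quartic_of (\<gamma> N))"
        using equiv[of n N] by (auto simp: SL2_orbit_def)
      then show ?thesis using inv q N that unfolding rational_invariant_def by (metis order_refl)
    qed
    then have "\<forall>\<^sub>F n in sequentially. p (\<gamma> N) / q (\<gamma> N) = p (\<gamma> n) / q (\<gamma> n)"
      by (rule eventually_sequentiallyI)
    then have "(\<lambda>n. p (\<gamma> n) / q (\<gamma> n)) \<longlonglongrightarrow> p (\<gamma> N) / q (\<gamma> N)"
      by (rule Lim_transform_eventually[OF tendsto_const])
    moreover have "(\<lambda>n. p (\<gamma> n) / q (\<gamma> n)) \<longlonglongrightarrow> p c / q c"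
      using inv q[of c] c U(2)
      by (intro tendsto_divide isCont_tendsto_compose[OF _ lim] continuous_poly_fun)
         (auto simp: rational_invariant_def)
    ultimately show ?thesis by (rule LIMSEQ_unique)
  qed
  \<comment> \<open>Both invariants take the same values at \<open>\<gamma> N\<close> as at
    \<open>c\<close>, and these values cut out the orbit.\<close>
  have "\<gamma> N \<in> ?O"
    using c N[of N] U(3) val[OF inv(1)] val[OF inv(2)] unfolding O by auto
  then show ?thesis by auto
qed

text \<open>Covariance carries the proportionality, with the same factor, along the orbit. This
  tells degenerate forms from the nearby forms that approximate them.\<close>

lemma hessian_proportional_orbit:
  assumes "\<And>v. J2 (jet_at (form 4 a) v) = k * form 4 a v" "form 4 a' \<in> SL2_orbit (form 4 a)"
  shows "J2 (jet_at (form 4 a') v) = k * form 4 a' v"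
proof -
  obtain B where "form 4 a' = form 4 a \<circ> (*v) B" "det B = 1" using assms(2) by (auto simp: SL2_orbit_eq)
  then show ?thesis using J_form_comp(2)[of B 4 a' a v] assms(1) by simp
qed

lemma tendsto_coeff_vec:
  assumes "\<And>i. i \<le> 4 \<Longrightarrow> ((\<lambda>n. a n i) \<longlongrightarrow> l i) F"
  shows "((\<lambda>n. coeff_vec (a n)) \<longlongrightarrow> coeff_vec l) F"
  unfolding coeff_vec_def by (rule vec_tendstoI) (simp add: assms)

lemma regular_quartic_sequence:
  fixes c0 c1 c2 c3 c4 :: "nat \<Rightarrow> complex"
  assumes "regular (quartic l0 l1 l2 l3 l4)"
    and "c0 \<longlonglongrightarrow> l0" "c1 \<longlonglongrightarrow> l1" "c2 \<longlonglongrightarrow> l2" "c3 \<longlonglongrightarrow> l3" "c4 \<longlonglongrightarrow> l4"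
    and "\<And>m n. quartic (c0 m) (c1 m) (c2 m) (c3 m) (c4 m) \<in> SL2_orbit (quartic (c0 n) (c1 n) (c2 n) (c3 n) (c4 n))"
  shows "\<exists>n. quartic (c0 n) (c1 n) (c2 n) (c3 n) (c4 n) \<in> SL2_orbit (quartic l0 l1 l2 l3 l4)"
proof -
  have "(\<lambda>n. coeffs5 (c0 n) (c1 n) (c2 n) (c3 n) (c4 n) i) \<longlonglongrightarrow> coeffs5 l0 l1 l2 l3 l4 i" if "i \<le> 4" for i
  proof -
    have "i = 0 \<or> i = 1 \<or> i = 2 \<or> i = 3 \<or> i = 4" using that by linarith
    then show ?thesis using assms by (auto intro!: tendsto_intros)
  qed
  then have "(\<lambda>n. coeff_vec (coeffs5 (c0 n) (c1 n) (c2 n) (c3 n) (c4 n))) \<longlonglongrightarrow> coeff_vec (coeffs5 l0 l1 l2 l3 l4)"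
    by (rule tendsto_coeff_vec)
  from regular_orbit_of_equivalent_sequence[OF _ this] assms(1,7) show ?thesis
    by (simp add: quartic_of_coeff_vec quartic_form)
qed

lemma J2_quartic:
  fixes c0 c1 c2 c3 c4 v
  defines "x \<equiv> v$1" and "y \<equiv> v$2"
  shows "J2 (jet_at (quartic c0 c1 c2 c3 c4) v) = 
    (2 * c2 * y^2 + 6 * c3 * x * y + 12 * c4 * x^2) * (12 * c0 * y^2 + 6 * c1 * x * y + 2 * c2 * x^2)
      - (3 * c1 * y^2 + 4 * c2 * x * y + 3 * c3 * x^2)^2"
  unfolding quartic_form J_form_4 x_def y_def by (simp add: mult.assoc)

lemma inverse_Suc_tendsto_0: "(\<lambda>n. inverse (of_nat (Suc n)) :: complex) \<longlonglongrightarrow> 0"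
  by (rule LIMSEQ_Suc[OF lim_inverse_n])

text \<open>The value \<open>c = 0\<close> is included and settles the zero form as well.\<close>

lemma not_regular_quadruple_root: "\<not> regular (quartic 0 0 0 0 c)"
proof
  assume reg: "regular (quartic 0 0 0 0 c)"
  define t :: "nat \<Rightarrow> complex" where "t n = inverse (of_nat (Suc n))" for n
  have lim: "t \<longlonglongrightarrow> 0" unfolding t_def by (rule inverse_Suc_tendsto_0)
  have t: "t n \<noteq> 0" for n unfolding t_def using of_nat_neq_0 by simp
  have "quartic 0 0 0 (t m) c \<in> SL2_orbit (quartic 0 0 0 (t n) c)" for m n
  proof -
    \<comment> \<open>Scaling by \<open>r\<close> turns \<open>t n\<close> into \<open>t m\<close>
      but disturbs the last coefficient, which the shear by \<open>s\<close> then restores.\<close>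
    define r where "r = csqrt (t m / t n)"
    have "r \<noteq> 0" using t by (simp add: r_def)
    have "t n * r^2 = t m" using t by (simp add: r_def)
    then have 1: "quartic 0 0 0 (t m) (c * r^4) \<in> SL2_orbit (quartic 0 0 0 (t n) c)"
      using quartic_scale[OF \<open>r \<noteq> 0\<close>, of 0 0 0 "t n" c] by simp
    define s where "s = (c - c * r^4) / t m"
    have "c * r^4 + s * t m = c" using t by (simp add: s_def)
    then show ?thesis
      using SL2_orbit_trans[OF 1 quartic_shear[of 0 0 s 0 "t m" "c * r^4"]] by simp
  qed
  then obtain n where n: "quartic 0 0 0 (t n) c \<in> SL2_orbit (quartic 0 0 0 0 c)"
    using regular_quartic_sequence[OF reg, of "\<lambda>n. 0" "\<lambda>n. 0" "\<lambda>n. 0" t "\<lambda>n. c",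
        OF tendsto_const tendsto_const tendsto_const lim tendsto_const]
    by blast
  have h: "J2 (jet_at (quartic 0 0 0 0 c) v) = 0 * quartic 0 0 0 0 c v" for v
    unfolding J2_quartic by simp
  have "J2 (jet_at (quartic 0 0 0 (t n) c) v) = 0 * quartic 0 0 0 (t n) c v" for v
    using hessian_proportional_orbit[OF h[unfolded quartic_form] n[unfolded quartic_form]]
    unfolding quartic_form .
  \<comment> \<open>At this point the Hessian equals \<open>- 9 * (t n)^2\<close>.\<close>
  from this[of "vector [1, 0]"] show False
    using t[of n] unfolding J2_quartic by simp
qed

lemma not_regular_two_double_roots: "\<not> regular (quartic 0 0 c 0 0)"
proof
  assume reg: "regular (quartic 0 0 c 0 0)"
  show False
  proof (cases "c = 0")
    case True
    then show False using reg not_regular_quadruple_root[of 0] by simp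
  next
    case False
    define t :: "nat \<Rightarrow> complex" where "t n = inverse (of_nat (Suc n))" for n
    have lim: "t \<longlonglongrightarrow> 0" unfolding t_def by (rule inverse_Suc_tendsto_0)
    have t: "t n \<noteq> 0" for n unfolding t_def using of_nat_neq_0 by simp
    have "quartic 0 0 c 0 (t m) \<in> SL2_orbit (quartic 0 0 c 0 (t n))" for m n
    proof -
      \<comment> \<open>A fourth root, since scaling multiplies the x^4 coefficient by
        \<open>r^4\<close> while fixing the middle one.\<close>
      define r where "r = csqrt (csqrt (t m / t n))"
      have "r \<noteq> 0" using t by (simp add: r_def)
      have "r ^ 4 = (r^2)^2" by (simp flip: power_mult)
      then have "t n * r^4 = t m" using t by (simp add: r_def)
      then show ?thesis using quartic_scale[OF \<open>r \<noteq> 0\<close>, of 0 0 c 0 "t n"] by simp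
    qed
    then obtain n where n: "quartic 0 0 c 0 (t n) \<in> SL2_orbit (quartic 0 0 c 0 0)"
      using regular_quartic_sequence[OF reg, of "\<lambda>n. 0" "\<lambda>n. 0" "\<lambda>n. c" "\<lambda>n. 0" t,
        OF tendsto_const tendsto_const tendsto_const tendsto_const lim]
      by blast
    have h: "J2 (jet_at (quartic 0 0 c 0 0) v) = - 12 * c * quartic 0 0 c 0 0 v" for v
      unfolding J2_quartic by (simp add: quartic_def algebra_simps eval_nat_numeral)
    have "J2 (jet_at (quartic 0 0 c 0 (t n)) v) = - 12 * c * quartic 0 0 c 0 (t n) v" for v
      using hessian_proportional_orbit[OF h[unfolded quartic_form] n[unfolded quartic_form]]
      unfolding quartic_form .
    \<comment> \<open>Here the Hessian is \<open>24 * c * t n\<close>, whereas proportionality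
      demands \<open>- 12 * c * t n\<close>.\<close>
    from this[of "vector [1, 0]"] show False
      using False t[of n] unfolding J2_quartic by (simp add: quartic_def)
  qed
qed

section \<open>Recovering the orbit from the equation\<close>

lemma regular_normal_form:
  assumes "regular (form 4 a)"
  shows "\<exists>p q. quartic 0 1 0 p q \<in> SL2_orbit (form 4 a)"
  using assms quartic_normal_form regular_orbit not_regular_two_double_roots not_regular_quadruple_root
  unfolding form_quartic by metis

text \<open>Subtracting the equation with the form's own invariants leaves J0^2 times a linear
  combination of J2 and J0. As J2 and J0 are linearly independent here, both coefficients
  vanish.\<close>

lemma normal_form_invariants:
  assumes "solves_ode \<alpha> \<delta> (quartic 0 1 0 p q)"
  shows "\<alpha> = 144 * p" "\<delta> = - 864 * q"
proof -
  let ?W = "quartic 0 1 0 p q"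
  have own: "solves_ode (144 * p) (- 864 * q) ?W"
    using solves_ode_own_invariants[of "coeffs5 0 1 0 p q"] by (simp add: quartic_form)
  \<comment> \<open>\<open>F\<close> and \<open>H\<close> are J0 and J2 restricted to the line on
    which y is 1.\<close>
  define F where "F = [:0, 1, 0, p, q:]"
  define H where "H = [:- 9, 0, 18 * p, 72 * q, - 9 * p^2:]"
  define k m where "k = 144 * (\<alpha> - 144 * p)" and "m = 864 * (\<delta> + 864 * q)"
  have "poly (F^2 * (smult k H + smult m F)) x = 0" for x
  proof -
    let ?v = "vector [x, 1] :: complex^2"
    have J0: "J0 (jet_at ?W ?v) = poly F x"
      unfolding quartic_form J_form_4 unfolding quartic_form[symmetric] 
      by (simp add: quartic_def F_def algebra_simps eval_nat_numeral)
    have J2: "J2 (jet_at ?W ?v) = poly H x"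
      unfolding J2_quartic by (simp add: H_def algebra_simps eval_nat_numeral)
    have "quartic_ode \<alpha> \<delta> (jet_at ?W ?v) - quartic_ode (144 * p) (- 864 * q) (jet_at ?W ?v) = 0"
      using assms own by (simp add: solves_ode_def)
    then have "poly F x ^ 2 * (k * poly H x + m * poly F x) = 0"
      unfolding quartic_ode_def J0 J2 k_def m_def by algebra
    then show ?thesis by simp
  qed
  then have "F^2 * (smult k H + smult m F) = 0" using poly_all_0_iff_0 by blast
  then have 0: "smult k H + smult m F = 0" by (auto simp: F_def)
  \<comment> \<open>The constant terms of \<open>H\<close> and \<open>F\<close> are -9 and 0, the
    linear coefficients 0 and 1.\<close>
  have "coeff (smult k H + smult m F) 0 = 0" "coeff (smult k H + smult m F) 1 = 0" unfolding 0 by simp_all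
  then have "k = 0" "m = 0" by (simp_all add: F_def H_def)
  then show "\<alpha> = 144 * p" "\<delta> = - 864 * q" unfolding k_def m_def by (simp_all only: mult_eq_0_iff) (simp_all add: eq_neg_iff_add_eq_0)
qed

theorem theorem15:
  fixes b :: "nat \<Rightarrow> nat \<Rightarrow> complex" and \<phi> :: "complex^2 \<Rightarrow> complex" and \<alpha> \<delta> :: complex
  assumes "\<phi> = binary_quartic b"
    and "regular \<phi>"
    and "\<alpha> = 4 * b 1 3 * b 3 1 - b 4 0 * b 0 4 - 3 * (b 2 2)\<^sup>2"
    and "\<delta> = b 2 2 * b 4 0 * b 0 4 - b 0 4 * (b 3 1)\<^sup>2 - b 4 0 * (b 1 3)\<^sup>2
             + 2 * b 1 3 * b 2 2 * b 3 1 - (b 2 2) ^ 3"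
  shows "SL2_orbit \<phi> = {f. regular f \<and> is_solution (insert (quartic_ode \<alpha> \<delta>) E4) f}"
proof -
  define a where "a = (\<lambda>i. b i (4 - i))"
  have \<phi>: "\<phi> = form 4 a" by (simp add: assms(1) binary_quartic_form a_def)
  have "solves_ode \<alpha> \<delta> \<phi>"
    using solves_ode_own_invariants[of a] unfolding \<phi> assms(3,4) by (simp add: a_def)
  then have orbit: "solves_ode \<alpha> \<delta> f" if "f \<in> SL2_orbit \<phi>" for f
    using that solves_ode_orbit unfolding \<phi> by blast
  obtain p q where W: "quartic 0 1 0 p q \<in> SL2_orbit \<phi>"
    using regular_normal_form assms(2) unfolding \<phi> by blast
  note inv = normal_form_invariants[OF orbit[OF W]]
  show ?thesis
  proof (intro equalityI subsetI CollectI)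
    fix f assume f: "f \<in> SL2_orbit \<phi>"
    then obtain a' where "f = form 4 a'" using orbit_form unfolding \<phi> by blast
    then show "regular f \<and> is_solution (insert (quartic_ode \<alpha> \<delta>) E4) f"
      using orbit[OF f] regular_orbit[OF assms(2) f] is_solution_form by simp
  next
    fix f assume "f \<in> {f. regular f \<and> is_solution (insert (quartic_ode \<alpha> \<delta>) E4) f}"
    then have f: "regular f" "is_solution (insert (quartic_ode \<alpha> \<delta>) E4) f" by auto
    obtain a' where a': "f = form 4 a'" using regular_imp_form[OF f(1)] .
    have sol: "solves_ode \<alpha> \<delta> (form 4 a')" using f(2) unfolding a' is_solution_form .
    obtain p' q' where W': "quartic 0 1 0 p' q' \<in> SL2_orbit f"
      using regular_normal_form f(1) unfolding a' by blast
    \<comment> \<open>Both normal forms solve the equation with the same \<open>\<alpha>\<close> and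
      \<open>\<delta>\<close>, which determine the two parameters.\<close>
    have "p' = p" "q' = q"
      using normal_form_invariants[OF solves_ode_orbit[OF sol W'[unfolded a']]] inv by simp_all
    then show "f \<in> SL2_orbit \<phi>"
      using W SL2_orbit_sym[OF W'] SL2_orbit_trans by blast
  qed
qed

end
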